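(* Let $A\in\mathbb{R}^{k\times n}$, let $\Gamma_{\mathrm{prior}}\in\mathbb{R}^{n\times n}$ and $\Gamma_{\mathrm{noise}}\in\mathbb{R}^{k\times k}$ be symmetric positive definite matrices, and let $y=Am+\eta$, where $m\sim\mathcal{N}(0,\Gamma_{\mathrm{prior}})$ and $\eta\sim\mathcal{N}(0,\Gamma_{\mathrm{noise}})$ are independent Gaussian random vectors. Let $\Gamma_{\mathrm{post}}:=(\Gamma_{\mathrm{prior}}^{-1}+A^\top\Gamma_{\mathrm{noise}}^{-1}A)^{-1}$, let $m_{\mathrm{LS}}:=A^+y$ be the minimum-norm least-squares estimate of $m$ given $y$, and let $m_{\mathrm{MAP}}:=\Gamma_{\mathrm{post}}A^\top\Gamma_{\mathrm{noise}}^{-1}y$ be the maximum-a-posteriori estimate. Define $$\delta_{\mathrm{prior}}:=\operatorname{tr}\left[(I-A^+A)(\Gamma_{\mathrm{prior}}-\Gamma_{\mathrm{post}})\right],\qquad \delta_{\mathrm{noise}}:=\operatorname{tr}\left[A^+\Gamma_{\mathrm{noise}}(A^+)^\top-A^+A\,\Gamma_{\mathrm{post}}\right].$$ Then $$\delta_{\mathrm{prior}}\ge 0,\qquad \delta_{\mathrm{noise}}\ge 0,\qquad \mathcal{R}(m_{\mathrm{LS}})-\mathcal{R}(m_{\mathrm{MAP}})=\delta_{\mathrm{prior}}+\delta_{\mathrm{noise}},$$ where $\mathcal{R}$ denotes the Bayes risk.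
   Context: $A^+$ denotes the Moore–Penrose pseudoinverse of $A$, and $I$ is the $n\times n$ identity matrix. For an estimator $\hat m$ (a function $y\mapsto\hat m(y)\in\mathbb{R}^n$ of the observations), its Bayes risk is $\mathcal{R}(\hat m):=\mathbb{E}_{m,y}\left[\|\hat m(y)-m\|_2^2\right]$, the expectation being over the joint distribution of $(m,y)$. *)

theory Defs
  imports "HOL-Probability.Probability"
begin

definition pos_def_matrix :: "real^'n^'n \<Rightarrow> bool" where
  "pos_def_matrix G \<longleftrightarrow> transpose G = G \<and> (\<forall>x. x \<noteq> 0 \<longrightarrow> x \<bullet> (G *v x) > 0)"

text \<open>The four Penrose equations, which have exactly one solution for every real matrix.\<close>
definition is_pinv :: "real^'n^'k \<Rightarrow> real^'k^'n \<Rightarrow> bool" where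
  "is_pinv A X \<longleftrightarrow>
     A ** X ** A = A \<and>
     X ** A ** X = X \<and>
     transpose (A ** X) = A ** X \<and>
     transpose (X ** A) = X ** A"

definition pinv :: "real^'n^'k \<Rightarrow> real^'k^'n" where
  "pinv A = (THE X. is_pinv A X)"

text \<open>Density of \<open>N(\<mu>, G)\<close> with respect to Lebesgue measure, meaningful for \<open>G\<close> symmetric
  positive definite.\<close>
definition gaussian_density :: "real^'n \<Rightarrow> real^'n^'n \<Rightarrow> real^'n \<Rightarrow> real" where
  "gaussian_density \<mu> G x =
     exp (- ((x - \<mu>) \<bullet> (matrix_inv G *v (x - \<mu>))) / 2) / sqrt ((2 * pi) ^ CARD('n) * det G)"

definition gaussian_vector :: "'w measure \<Rightarrow> ('w \<Rightarrow> real^'n) \<Rightarrow> real^'n \<Rightarrow> real^'n^'n \<Rightarrow> bool" where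
  "gaussian_vector M X \<mu> G \<longleftrightarrow> distributed M lborel X (\<lambda>x. ennreal (gaussian_density \<mu> G x))"

text \<open>Library \<open>indep_var\<close> forces both variables to have the same value type; here the generated
  sigma-algebras are required to be independent, which allows different dimensions.\<close>
definition indep_vectors ::
  "'w measure \<Rightarrow> ('w \<Rightarrow> real^'n) \<Rightarrow> ('w \<Rightarrow> real^'k) \<Rightarrow> bool" where
  "indep_vectors M X Y \<longleftrightarrow>
     prob_space.indep_set M
       {X -` S \<inter> space M | S. S \<in> sets borel}
       {Y -` S \<inter> space M | S. S \<in> sets borel}"

text \<open>The estimator \<open>f\<close> sees only the observation \<open>y\<close>; \<open>m\<close> is the unknown. The expectation is
  a Bochner integral against the joint law of \<open>(m, y)\<close>.\<close>
definition bayes_risk ::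
  "'w measure \<Rightarrow> ('w \<Rightarrow> real^'n) \<Rightarrow> ('w \<Rightarrow> real^'k) \<Rightarrow> (real^'k \<Rightarrow> real^'n) \<Rightarrow> real" where
  "bayes_risk M m y f =
     (\<integral>(u, v). (norm (f v - u))\<^sup>2 \<partial>distr M (borel \<Otimes>\<^sub>M borel) (\<lambda>\<omega>. (m \<omega>, y \<omega>)))"

definition post_cov :: "real^'n^'k \<Rightarrow> real^'n^'n \<Rightarrow> real^'k^'k \<Rightarrow> real^'n^'n" where
  "post_cov A Gprior Gnoise =
     matrix_inv (matrix_inv Gprior + transpose A ** matrix_inv Gnoise ** A)"

definition ls_estimate :: "real^'n^'k \<Rightarrow> real^'k \<Rightarrow> real^'n" where
  "ls_estimate A v = pinv A *v v"

definition map_estimate ::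
  "real^'n^'k \<Rightarrow> real^'n^'n \<Rightarrow> real^'k^'k \<Rightarrow> real^'k \<Rightarrow> real^'n" where
  "map_estimate A Gprior Gnoise v =
     (post_cov A Gprior Gnoise ** transpose A ** matrix_inv Gnoise) *v v"

definition delta_prior :: "real^'n^'k \<Rightarrow> real^'n^'n \<Rightarrow> real^'k^'k \<Rightarrow> real" where
  "delta_prior A Gprior Gnoise =
     trace ((mat 1 - pinv A ** A) ** (Gprior - post_cov A Gprior Gnoise))"

definition delta_noise :: "real^'n^'k \<Rightarrow> real^'n^'n \<Rightarrow> real^'k^'k \<Rightarrow> real" where
  "delta_noise A Gprior Gnoise =
     trace (pinv A ** Gnoise ** transpose (pinv A) - pinv A ** A ** post_cov A Gprior Gnoise)"

end

theory Submission
  imports Defs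
begin

text \<open>
  Write \<open>P\<close> and \<open>N\<close> for the prior and noise covariances, \<open>S\<close> for the posterior covariance
  and \<open>K = S A\<^sup>T N\<^sup>-\<^sup>1\<close> for the MAP gain.

  Both estimators are linear in the data, and a linear estimator \<open>L\<close> makes the error
  \<open>L y - m = (L A - I) m + L \<eta>\<close>, a sum of two independent centred Gaussian vectors. Its
  risk is therefore \<open>tr ((L A - I) P (L A - I)\<^sup>T) + tr (L N L\<^sup>T)\<close> (\<open>bayes_risk_linear\<close>).
  The identity \<open>K A = I - S P\<^sup>-\<^sup>1\<close> turns this into \<open>tr S\<close> for \<open>L = K\<close>
  (\<open>map_error_covariance\<close>). For \<open>L = A\<^sup>+\<close> the matrix \<open>I - A\<^sup>+ A\<close> is an orthogonal
  projection, so that the risk is \<open>tr ((I - A\<^sup>+ A) P) + tr (A\<^sup>+ N (A\<^sup>+)\<^sup>T)\<close>; splitting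
  \<open>tr S\<close> along \<open>I = (I - A\<^sup>+ A) + A\<^sup>+ A\<close> gives the two terms of the risk gap
  (\<open>ls_map_trace_gap\<close>).

  The terms are nonnegative because \<open>P - S\<close> and \<open>N - A S A\<^sup>T\<close> are sums of congruences
  \<open>C G C\<^sup>T\<close> of positive definite matrices (\<open>prior_minus_post\<close>, \<open>noise_minus_fitted_post\<close>).
  The first says that observing cannot increase the covariance. In the second, \<open>A S A\<^sup>T\<close> is
  the posterior covariance of the noise-free data \<open>A m\<close>, which cannot exceed the covariance
  of the error that the raw observation makes. Multiplying by the projections or by \<open>A\<^sup>+\<close> on
  both sides keeps the congruence form, whose trace is nonnegative.

  The second moments of the Gaussian vectors are obtained without diagonalising a
  covariance: completing the square and the translation invariance of Lebesgue measure yield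
  the moment generating function of every linear functional, which determines its variance
  and turns independent sums into products.
\<close>

section \<open>Symmetric and positive definite matrices\<close>

lemma matrix_add_rdistrib: "((B :: 'a::semiring_1^'n^'m) + C) ** A = B ** A + C ** A"
  by (simp add: matrix_matrix_mult_def vec_eq_iff sum.distrib distrib_right)

lemma matrix_sub_ldistrib: "(A :: 'a::ring_1^'n^'m) ** (B - C) = A ** B - A ** C"
  by (simp add: matrix_matrix_mult_def vec_eq_iff sum_subtractf right_diff_distrib)

lemma matrix_sub_rdistrib: "((B :: 'a::ring_1^'n^'m) - C) ** A = B ** A - C ** A"
  by (simp add: matrix_matrix_mult_def vec_eq_iff sum_subtractf left_diff_distrib)

lemma transpose_add: "transpose (A + B) = transpose A + transpose B"
  by (simp add: transpose_def vec_eq_iff)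

lemma transpose_sub: "transpose (A - B) = transpose A - transpose B"
  by (simp add: transpose_def vec_eq_iff)

lemmas matrix_ring_simps =
  matrix_add_ldistrib matrix_add_rdistrib matrix_sub_ldistrib matrix_sub_rdistrib
  transpose_add transpose_sub matrix_transpose_mul matrix_mul_assoc

lemma congruence_diff_commute:
  fixes B C :: "real^'m^'n" and G :: "real^'m^'m"
  shows "(B - C) ** G ** transpose (B - C) = (C - B) ** G ** transpose (C - B)"
  by (simp add: matrix_ring_simps)

text \<open>With \<open>G\<close> a covariance, both sides are the expected squared norm of \<open>C X\<close>: the right-hand
  side adds the variances of its coordinates. Positivity of the trace is also read off here.\<close>

lemma trace_congruence_eq_sum:
  fixes C :: "real^'m^'n" and G :: "real^'m^'m"
  shows "trace (C ** G ** transpose C) = (\<Sum>i\<in>UNIV. C $ i \<bullet> (G *v (C $ i)))"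
proof -
  have "(C ** G ** transpose C) $ i $ i = C $ i \<bullet> (G *v (C $ i))" for i
    unfolding matrix_mul_assoc[symmetric]
    unfolding matrix_matrix_mult_def transpose_def
    by (simp add: inner_vec_def matrix_vector_mult_def sum_distrib_left)
  then show ?thesis
    by (simp add: trace_def)
qed

lemma trace_congruence_nonneg:
  fixes C :: "real^'m^'n" and G :: "real^'m^'m"
  assumes "pos_def_matrix G"
  shows "trace (C ** G ** transpose C) \<ge> 0"
  unfolding trace_congruence_eq_sum
proof (rule sum_nonneg)
  fix i show "C $ i \<bullet> (G *v (C $ i)) \<ge> 0"
    using assms by (cases "C $ i = 0") (auto simp: pos_def_matrix_def less_imp_le)
qed

lemma pos_def_matrix_invertible:
  assumes "pos_def_matrix G"
  shows "invertible G"
proof -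
  have "x = 0" if "G *v x = 0" for x
    using assms that by (force simp: pos_def_matrix_def)
  then show ?thesis
    using matrix_left_invertible_ker[of G] invertible_left_inverse[of G] by blast
qed

lemma matrix_inv_inverse:
  fixes G :: "real^'n^'n"
  assumes "invertible G"
  shows "G ** matrix_inv G = mat 1" and "matrix_inv G ** G = mat 1"
proof -
  have "\<exists>H. G ** H = mat 1 \<and> H ** G = mat 1"
    using assms by (simp add: invertible_def)
  then have "G ** matrix_inv G = mat 1 \<and> matrix_inv G ** G = mat 1"
    unfolding matrix_inv_def by (rule someI_ex)
  then show "G ** matrix_inv G = mat 1" and "matrix_inv G ** G = mat 1"
    by auto
qed

lemma transpose_matrix_inv:
  fixes G :: "real^'n^'n"
  assumes "invertible G" and "transpose G = G"
  shows "transpose (matrix_inv G) = matrix_inv G"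
proof -
  note GI = matrix_inv_inverse[OF assms(1)]
  have "transpose (matrix_inv G) ** G = mat 1"
    by (metis GI(1) assms(2) matrix_transpose_mul transpose_mat)
  then show ?thesis
    by (metis GI(1) matrix_mul_assoc matrix_mul_lid matrix_mul_rid)
qed

text \<open>Substituting \<open>x = G z\<close> turns the quadratic form of the inverse into that of \<open>G\<close>.\<close>

lemma pos_def_matrix_inv:
  fixes G :: "real^'n^'n"
  assumes "pos_def_matrix G"
  shows "pos_def_matrix (matrix_inv G)"
proof -
  have sym: "transpose G = G" and pos: "\<And>x. x \<noteq> 0 \<Longrightarrow> x \<bullet> (G *v x) > 0"
    using assms by (auto simp: pos_def_matrix_def)
  note inv = pos_def_matrix_invertible[OF assms]
  have "x \<bullet> (matrix_inv G *v x) > 0" if "x \<noteq> 0" for x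
  proof -
    have x: "G *v (matrix_inv G *v x) = x"
      by (simp add: matrix_vector_mul_assoc matrix_inv_inverse[OF inv])
    then have "matrix_inv G *v x \<noteq> 0"
      using that by auto
    then show ?thesis
      using pos[of "matrix_inv G *v x"] x by (simp add: inner_commute)
  qed
  then show ?thesis
    by (simp add: pos_def_matrix_def transpose_matrix_inv[OF inv sym])
qed

lemma inner_transpose: "(A *v x) \<bullet> y = (x :: real^'n) \<bullet> (transpose A *v y)"
  by (metis dot_lmul_matrix inner_commute transpose_matrix_vector transpose_transpose)

lemma pos_def_matrix_add_congruence:
  fixes G :: "real^'n^'n" and C :: "real^'n^'k" and H :: "real^'k^'k"
  assumes G: "pos_def_matrix G" and H: "pos_def_matrix H"
  shows "pos_def_matrix (G + transpose C ** H ** C)"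
  unfolding pos_def_matrix_def
proof (intro conjI allI impI)
  show "transpose (G + transpose C ** H ** C) = G + transpose C ** H ** C"
    using G H by (simp add: pos_def_matrix_def matrix_ring_simps)
  fix x :: "real^'n" assume "x \<noteq> 0"
  then have "x \<bullet> (G *v x) > 0"
    using G by (simp add: pos_def_matrix_def)
  moreover have "(C *v x) \<bullet> (H *v (C *v x)) \<ge> 0"
    using H by (cases "C *v x = 0") (auto simp: pos_def_matrix_def less_imp_le)
  then have "x \<bullet> ((transpose C ** H ** C) *v x) \<ge> 0"
    by (simp add: inner_transpose flip: matrix_vector_mul_assoc)
  ultimately show "x \<bullet> ((G + transpose C ** H ** C) *v x) > 0"
    by (simp add: matrix_vector_mult_add_rdistrib inner_add_right)
qed

section \<open>The Moore-Penrose pseudoinverse\<close>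

text \<open>A right inverse of \<open>A\<close> on its range, extended linearly to the whole space. In general
  it satisfies the first Penrose equation only; the lemmas below build the pseudoinverse from such matrices.\<close>

lemma generalized_inverse_exists:
  fixes A :: "real^'n^'k"
  shows "\<exists>Y. A ** Y ** A = A"
proof -
  obtain g where g: "Vector_Spaces.linear (*s) (*s) g" "\<And>x. A *v g (A *v x) = A *v x"
    using vec.linear_exists_right_inverse_on[OF matrix_vector_mul_linear_gen[of A] vec.subspace_UNIV]
    by auto
  have "A ** matrix g ** A = A"
    by (simp add: matrix_eq matrix_works[OF g(1)] g(2) flip: matrix_vector_mul_assoc)
  then show ?thesis ..
qed

text \<open>The null spaces of \<open>A\<^sup>T A\<close> and \<open>A\<close> agree, since \<open>A\<^sup>T A z = 0\<close> forces \<open>\<parallel>A z\<parallel>\<^sup>2 = z \<bullet> A\<^sup>T A z = 0\<close>.\<close>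

lemma transpose_mult_cancel:
  fixes A :: "real^'n^'k" and B C :: "real^'m^'n"
  assumes "transpose A ** A ** B = transpose A ** A ** C"
  shows "A ** B = A ** C"
proof -
  have "A *v ((B - C) *v x) = 0" for x
  proof -
    let ?z = "(B - C) *v x"
    have "transpose A *v (A *v ?z) = 0"
      using assms by (simp add: matrix_vector_mul_assoc matrix_ring_simps)
    then have "(A *v ?z) \<bullet> (A *v ?z) = 0"
      by (simp add: inner_transpose)
    then show ?thesis by simp
  qed
  then show ?thesis
    by (simp add: matrix_eq matrix_vector_mult_diff_rdistrib matrix_vector_mult_diff_distrib
        flip: matrix_vector_mul_assoc)
qed

text \<open>If \<open>Y\<close> is a generalized inverse of \<open>A\<^sup>T A\<close>, then \<open>U = Y A\<^sup>T\<close> solves the normal equations,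
  and \<open>A U\<close> is the orthogonal projection onto the range of \<open>A\<close>.\<close>

lemma least_squares_inverse_exists:
  fixes A :: "real^'n^'k"
  shows "\<exists>U. A ** U ** A = A \<and> transpose (A ** U) = A ** U"
proof -
  obtain Y where Y: "transpose A ** A ** Y ** (transpose A ** A) = transpose A ** A"
    using generalized_inverse_exists by blast
  define U where "U = Y ** transpose A"
  have AUA: "A ** U ** A = A"
    using transpose_mult_cancel[of A "Y ** transpose A ** A" "mat 1"] Y
    by (simp add: U_def matrix_mul_assoc)
  \<comment> \<open>A matrix of the form \<open>B B\<^sup>T\<close> is symmetric, so it suffices to write \<open>A U\<close> in this way.\<close>
  have "A ** U = A ** Y ** transpose (A ** U ** A)"
    by (simp add: AUA) (simp add: U_def matrix_mul_assoc)
  also have "\<dots> = A ** U ** transpose (A ** U)"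
    by (simp add: U_def matrix_ring_simps)
  finally have "A ** U = A ** U ** transpose (A ** U)" .
  then have "transpose (A ** U) = A ** U"
    by (metis matrix_transpose_mul transpose_transpose)
  with AUA show ?thesis by blast
qed

text \<open>Urquhart's formula \<open>A\<^sup>+ = V A U\<close>: the right factor \<open>U\<close> makes \<open>A A\<^sup>+ = A U\<close> the
  projection onto the range of \<open>A\<close>, and the left factor \<open>V\<close>, obtained by transposing the same
  construction for \<open>A\<^sup>T\<close>, makes \<open>A\<^sup>+ A = V A\<close> the projection onto the range of \<open>A\<^sup>T\<close>.\<close>

lemma is_pinv_exists:
  fixes A :: "real^'n^'k"
  shows "\<exists>X. is_pinv A X"
proof -
  obtain U where U: "A ** U ** A = A" "transpose (A ** U) = A ** U"
    using least_squares_inverse_exists by blast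
  obtain V' where V': "transpose A ** V' ** transpose A = transpose A"
      "transpose (transpose A ** V') = transpose A ** V'"
    using least_squares_inverse_exists by blast
  define V where "V = transpose V'"
  have V: "A ** V ** A = A" "transpose (V ** A) = V ** A"
  proof -
    have "transpose (transpose A ** V' ** transpose A) = transpose (transpose A)"
      by (simp only: V'(1))
    then show "A ** V ** A = A"
      by (simp add: V_def matrix_transpose_mul matrix_mul_assoc)
    show "transpose (V ** A) = V ** A"
      using V'(2) by (simp add: V_def matrix_transpose_mul)
  qed
  have AX: "A ** (V ** A ** U) = A ** U"
    using V(1) by (simp add: matrix_mul_assoc)
  have XA: "V ** A ** U ** A = V ** A"
    using U(1) by (simp add: matrix_mul_assoc[symmetric])
  have "is_pinv A (V ** A ** U)"
    unfolding is_pinv_def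
  proof (intro conjI)
    show "A ** (V ** A ** U) ** A = A"
      by (simp only: AX U)
    show "V ** A ** U ** A ** (V ** A ** U) = V ** A ** U"
      by (metis AX XA matrix_mul_assoc)
  qed (simp_all only: AX XA U V)
  then show ?thesis ..
qed

text \<open>Symmetric idempotents with the same range coincide; hence \<open>A X = A Y\<close> and \<open>X A = Y A\<close>,
  and \<open>X = X A X\<close> depends only on these products.\<close>

lemma is_pinv_unique:
  assumes X: "is_pinv A X" and Y: "is_pinv A Y"
  shows "X = Y"
proof -
  have "A ** X = A ** Y ** (A ** X)"
    using Y by (simp add: is_pinv_def matrix_mul_assoc)
  also have "\<dots> = transpose (A ** X ** (A ** Y))"
    using X Y by (simp add: is_pinv_def matrix_transpose_mul)
  also have "\<dots> = A ** Y"
    using X Y by (simp add: is_pinv_def matrix_mul_assoc)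
  finally have AX: "A ** X = A ** Y" .
  have "X ** A = X ** A ** (Y ** A)"
    using Y by (simp add: is_pinv_def matrix_mul_assoc[symmetric])
  also have "\<dots> = transpose (Y ** A ** (X ** A))"
    using X Y by (simp add: is_pinv_def matrix_transpose_mul)
  also have "\<dots> = Y ** A"
    using X Y by (simp add: is_pinv_def matrix_mul_assoc[symmetric])
  finally have XA: "X ** A = Y ** A" .
  have "X = X ** A ** X"
    using X by (simp add: is_pinv_def)
  also have "\<dots> = Y ** A ** Y"
    using AX XA by (simp add: matrix_mul_assoc[symmetric])
  also have "\<dots> = Y"
    using Y by (simp add: is_pinv_def)
  finally show ?thesis .
qed

lemma is_pinv_pinv: "is_pinv A (pinv A)"
  unfolding pinv_def using is_pinv_exists is_pinv_unique by (metis theI)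

lemma pinv_projection:
  fixes A :: "real^'n^'k"
  shows "transpose (pinv A ** A) = pinv A ** A" and "pinv A ** A ** (pinv A ** A) = pinv A ** A"
  using is_pinv_pinv[of A] by (auto simp: is_pinv_def matrix_mul_assoc)

text \<open>Cyclicity of the trace lets a one-sided projection act on both sides, which brings the traces
  of the risk gap into congruence form.\<close>

lemma trace_symmetric_projection:
  fixes Q G :: "real^'n^'n"
  assumes "transpose Q = Q" and "Q ** Q = Q"
  shows "trace (Q ** G ** transpose Q) = trace (Q ** G)"
  by (metis assms matrix_mul_assoc trace_mul_sym)

section \<open>Moments of Gaussian vectors\<close>

text \<open>The moment generating function of a centred normal variable of variance \<open>s\<close>. Unlike a
  density, it makes sense for \<open>s = 0\<close>, which occurs when a row of an estimator vanishes.\<close>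

definition has_gaussian_mgf :: "'w measure \<Rightarrow> ('w \<Rightarrow> real) \<Rightarrow> real \<Rightarrow> bool" where
  "has_gaussian_mgf M Z s \<longleftrightarrow>
     Z \<in> borel_measurable M \<and>
     (\<forall>t. has_bochner_integral M (\<lambda>\<omega>. exp (t * Z \<omega>)) (exp (t\<^sup>2 * s / 2)))"

text \<open>A global bound with the correct quadratic order at \<open>0\<close>, so that dividing by the square of
  the step leaves an integrable majorant that does not depend on the step.\<close>

lemma exp_second_difference_bound:
  fixes x :: real
  shows "\<bar>exp x + exp (- x) - 2\<bar> \<le> x\<^sup>2 * exp \<bar>x\<bar>"
proof -
  have *: "\<bar>exp x + exp (- x) - 2\<bar> \<le> x\<^sup>2 * exp x" if "x \<ge> 0" for x :: real
  proof -
    have eq: "exp x + exp (- x) - 2 = (1 - exp (- x))\<^sup>2 * exp x"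
      by (simp add: power2_eq_square algebra_simps flip: exp_add)
    have "0 \<le> 1 - exp (- x)" "1 - exp (- x) \<le> x"
      using that exp_ge_add_one_self[of "- x"] by auto
    then have "(1 - exp (- x))\<^sup>2 \<le> x\<^sup>2"
      by (rule power_mono[rotated])
    then show ?thesis
      unfolding eq by (simp add: abs_mult)
  qed
  show ?thesis
    using *[of x] *[of "- x"] by (cases "x \<ge> 0") (auto simp: add.commute)
qed

lemma second_difference_at_0_tendsto:
  fixes a :: real
  shows "(\<lambda>n. (exp (a / Suc n) + exp (- (a / Suc n)) - 2) * (Suc n)\<^sup>2) \<longlonglongrightarrow> a\<^sup>2"
  unfolding power2_eq_square[of a] by real_asymp

text \<open>The second moment is the second derivative of the moment generating function at \<open>0\<close>. It is
  computed as the limit of the second differences \<open>(e\<^bsup>tZ\<^esup> + e\<^bsup>-tZ\<^esup> - 2) / t\<^sup>2\<close> along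
  \<open>t = 1 / (n + 1)\<close>, by dominated convergence.\<close>

lemma gaussian_mgf_second_moment:
  assumes "has_gaussian_mgf M Z s"
  shows "has_bochner_integral M (\<lambda>\<omega>. (Z \<omega>)\<^sup>2) s"
proof -
  define u :: "nat \<Rightarrow> real \<Rightarrow> real" where
    "u n z = (exp (z / Suc n) + exp (- (z / Suc n)) - 2) * (Suc n)\<^sup>2" for n z
  \<comment> \<open>The majorant \<open>z\<^sup>2 e\<^bsup>\<bar>z\<bar>\<^esup> \<le> 2 e\<^bsup>2\<bar>z\<bar>\<^esup>\<close>, with the absolute value removed to make it a sum of exponentials of \<open>z\<close>.\<close>
  define w :: "real \<Rightarrow> real" where "w z = 2 * (exp (2 * z) + exp (- 2 * z))" for z
  have [measurable]: "Z \<in> borel_measurable M"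
    and mgf: "has_bochner_integral M (\<lambda>\<omega>. exp (t * Z \<omega>)) (exp (t\<^sup>2 * s / 2))" for t
    using assms by (auto simp: has_gaussian_mgf_def)
  \<comment> \<open>At \<open>t = 0\<close> the hypothesis says that the measure has total mass one.\<close>
  have "has_bochner_integral M (\<lambda>\<omega>. exp (0 * Z \<omega>)) (exp (0\<^sup>2 * s / 2))"
    by (rule mgf)
  then have one: "has_bochner_integral M (\<lambda>\<omega>. 2) (2::real)"
    using has_bochner_integral_add[of M "\<lambda>\<omega>. 1::real" 1 "\<lambda>\<omega>. 1" 1] by simp
  have int: "has_bochner_integral M (\<lambda>\<omega>. u n (Z \<omega>)) ((2 * exp ((1 / Suc n)\<^sup>2 * s / 2) - 2) * (Suc n)\<^sup>2)" for n
  proof -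
    have "has_bochner_integral M
        (\<lambda>\<omega>. (exp ((1 / Suc n) * Z \<omega>) + exp ((- 1 / Suc n) * Z \<omega>) - 2) * (Suc n)\<^sup>2)
        ((exp ((1 / Suc n)\<^sup>2 * s / 2) + exp ((- 1 / Suc n)\<^sup>2 * s / 2) - 2) * (Suc n)\<^sup>2)"
      by (intro has_bochner_integral_mult_left has_bochner_integral_diff
          has_bochner_integral_add mgf one)
    then show ?thesis
      by (simp add: u_def power_divide)
  qed
  have bound: "norm (u n z) \<le> w z" for n z
  proof -
    have "\<bar>u n z\<bar> \<le> (z / Suc n)\<^sup>2 * exp \<bar>z / Suc n\<bar> * (Suc n)\<^sup>2"
      unfolding u_def abs_mult
      using exp_second_difference_bound[of "z / Suc n"] by (intro mult_mono) auto
    also have "\<dots> = z\<^sup>2 * exp (\<bar>z\<bar> / Suc n)"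
      by (simp add: power_divide)
    also have "\<dots> \<le> (2 * exp \<bar>z\<bar>) * exp \<bar>z\<bar>"
    proof (intro mult_mono)
      show "z\<^sup>2 \<le> 2 * exp \<bar>z\<bar>"
        using exp_lower_Taylor_quadratic[of "\<bar>z\<bar>"] by simp
      have "\<bar>z\<bar> / Suc n \<le> \<bar>z\<bar> / 1"
        by (intro divide_left_mono) auto
      then show "exp (\<bar>z\<bar> / Suc n) \<le> exp \<bar>z\<bar>"
        by simp
    qed auto
    also have "\<dots> = 2 * exp (2 * \<bar>z\<bar>)"
      by (simp flip: exp_add)
    also have "\<dots> \<le> w z"
      by (auto simp: w_def abs_if)
    finally show ?thesis by simp
  qed
  have meas: "(\<lambda>\<omega>. u n (Z \<omega>)) \<in> borel_measurable M" for n
    unfolding u_def by measurable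
  have w: "integrable M (\<lambda>\<omega>. w (Z \<omega>))"
    unfolding w_def using mgf[of 2] mgf[of "- 2"]
    by (auto intro!: integrable_mult_right integrable_add dest: has_bochner_integral_iff[THEN iffD1])
  have lim: "(\<lambda>n. u n z) \<longlonglongrightarrow> z\<^sup>2" for z
    unfolding u_def by (rule second_difference_at_0_tendsto)
  note dc = meas w AE_I2[OF lim] AE_I2[OF bound]
  have "integrable M (\<lambda>\<omega>. (Z \<omega>)\<^sup>2)"
    by (rule integrable_dominated_convergence[OF _ dc]) measurable
  moreover have "(\<lambda>n. integral\<^sup>L M (\<lambda>\<omega>. u n (Z \<omega>))) \<longlonglongrightarrow> (\<integral>\<omega>. (Z \<omega>)\<^sup>2 \<partial>M)"
    by (rule integral_dominated_convergence[OF _ dc]) measurable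
  moreover have "(\<lambda>n. integral\<^sup>L M (\<lambda>\<omega>. u n (Z \<omega>))) \<longlonglongrightarrow> s"
  proof -
    have "(\<lambda>n. (2 * exp ((1 / Suc n)\<^sup>2 * s / 2) - 2) * (Suc n)\<^sup>2) \<longlonglongrightarrow> s"
      by real_asymp
    then show ?thesis
      using int by (simp add: has_bochner_integral_iff)
  qed
  ultimately show ?thesis
    using LIMSEQ_unique by (auto simp: has_bochner_integral_iff)
qed

lemma gaussian_mgf_add:
  assumes "prob_space M" and "has_gaussian_mgf M Z s" and "has_gaussian_mgf M W r"
    and ind: "prob_space.indep_var M borel Z borel W"
  shows "has_gaussian_mgf M (\<lambda>\<omega>. Z \<omega> + W \<omega>) (s + r)"
proof -
  interpret prob_space M by fact
  have [measurable]: "Z \<in> borel_measurable M" "W \<in> borel_measurable M"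
    and Z: "has_bochner_integral M (\<lambda>\<omega>. exp (t * Z \<omega>)) (exp (t\<^sup>2 * s / 2))"
    and W: "has_bochner_integral M (\<lambda>\<omega>. exp (t * W \<omega>)) (exp (t\<^sup>2 * r / 2))" for t
    using assms by (auto simp: has_gaussian_mgf_def)
  have "has_bochner_integral M (\<lambda>\<omega>. exp (t * (Z \<omega> + W \<omega>))) (exp (t\<^sup>2 * (s + r) / 2))" for t
  proof -
    have "indep_var borel ((\<lambda>z. exp (t * z)) \<circ> Z) borel ((\<lambda>z. exp (t * z)) \<circ> W)"
      by (rule indep_var_compose[OF ind]) measurable
    then have "indep_var borel (\<lambda>\<omega>. exp (t * Z \<omega>)) borel (\<lambda>\<omega>. exp (t * W \<omega>))"
      by (simp add: comp_def)
    then have "has_bochner_integral M (\<lambda>\<omega>. exp (t * Z \<omega>) * exp (t * W \<omega>))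
        (exp (t\<^sup>2 * s / 2) * exp (t\<^sup>2 * r / 2))"
      using Z[of t] W[of t]
      by (simp add: has_bochner_integral_iff indep_var_integrable indep_var_lebesgue_integral)
    then show ?thesis
      by (simp add: distrib_left add_divide_distrib exp_add)
  qed
  then show ?thesis
    by (auto simp: has_gaussian_mgf_def)
qed

text \<open>Real-valued functions of the two vectors have a common value type, so the library notion of
  independence applies to them: they generate smaller sigma-algebras.\<close>

lemma indep_vectors_inner:
  assumes "prob_space M" and X[measurable]: "X \<in> borel_measurable M" and Y[measurable]: "Y \<in> borel_measurable M"
    and ind: "indep_vectors M X Y"
  shows "prob_space.indep_var M borel (\<lambda>\<omega>. b \<bullet> X \<omega>) borel (\<lambda>\<omega>. c \<bullet> Y \<omega>)"
proof -
  interpret prob_space M by fact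
  have sub: "\<exists>S'. (\<lambda>\<omega>. d \<bullet> V \<omega>) -` S \<inter> space M = V -` S' \<inter> space M \<and> S' \<in> sets borel"
    if "S \<in> sets borel" for d :: "real^'x" and V :: "_ \<Rightarrow> real^'x" and S
  proof (intro exI conjI)
    have "(\<lambda>v. d \<bullet> v) \<in> borel_measurable borel"
      by measurable
    then show "(\<lambda>v. d \<bullet> v) -` S \<in> sets borel"
      using that by (rule measurable_sets_borel)
  qed auto
  have "indep_sets (case_bool {X -` S \<inter> space M | S. S \<in> sets borel}
      {Y -` S \<inter> space M | S. S \<in> sets borel}) UNIV"
    using ind by (simp add: indep_vectors_def indep_set_def)
  then have "indep_sets (\<lambda>i. {case_bool (\<lambda>\<omega>. b \<bullet> X \<omega>) (\<lambda>\<omega>. c \<bullet> Y \<omega>) i -` S \<inter> space M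
      | S. S \<in> sets (case_bool borel borel i)}) UNIV"
    by (rule indep_sets_mono_sets) (auto split: bool.splits intro: sub)
  then show ?thesis
    unfolding indep_var_def indep_vars_def2 by (auto split: bool.splits)
qed

lemma gaussian_vector_measurable:
  "gaussian_vector M X \<mu> G \<Longrightarrow> X \<in> borel_measurable M"
  by (auto simp: gaussian_vector_def distributed_def)

text \<open>Completing the square: tilting a centred Gaussian density by \<open>e\<^bsup>b \<bullet> x\<^esup>\<close> recentres it at
  \<open>G b\<close>.\<close>

lemma gaussian_density_shift:
  fixes G :: "real^'n^'n"
  assumes sym: "transpose G = G" and inv: "invertible G"
  shows "gaussian_density 0 G x * exp (b \<bullet> x) = exp (b \<bullet> (G *v b) / 2) * gaussian_density 0 G (x - G *v b)"
proof -
  define H where "H = matrix_inv G"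
  have HG: "H *v (G *v v) = v" and GH: "G *v (H *v v) = v" for v
    using matrix_inv_inverse[OF inv] by (simp_all add: H_def matrix_vector_mul_assoc)
  have cross: "(G *v b) \<bullet> (H *v x) = b \<bullet> x"
    by (simp add: inner_transpose sym GH)
  have "(x - G *v b) \<bullet> (H *v (x - G *v b)) = x \<bullet> (H *v x) - 2 * (b \<bullet> x) + b \<bullet> (G *v b)"
    by (simp add: matrix_vector_mult_diff_distrib HG inner_diff_left inner_diff_right cross inner_commute)
  then show ?thesis
    unfolding gaussian_density_def H_def[symmetric]
    by (simp add: field_simps flip: exp_add)
qed

text \<open>Integrate the tilting identity. The translated density has the same integral as the
  original one, and this integral is \<open>1\<close> because the density is that of a random vector; the
  normalising constant, and hence the determinant, is never evaluated.\<close>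

lemma gaussian_vector_inner_mgf:
  fixes X :: "'w \<Rightarrow> real^'n"
  assumes "prob_space M" and G: "transpose G = G" "invertible G"
    and X: "gaussian_vector M X 0 G"
  shows "has_gaussian_mgf M (\<lambda>\<omega>. b \<bullet> X \<omega>) (b \<bullet> (G *v b))"
proof -
  interpret prob_space M by fact
  have [measurable]: "X \<in> borel_measurable M"
    using X by (rule gaussian_vector_measurable)
  let ?g = "\<lambda>x. ennreal (gaussian_density 0 G x)"
  have D: "distributed M lborel X ?g"
    using X by (simp add: gaussian_vector_def)
  then have [measurable]: "?g \<in> borel_measurable borel"
    by (auto simp: distributed_def)
  have total: "(\<integral>\<^sup>+x. ?g x \<partial>lborel) = 1"
    using distributed_nn_integral[OF D, of "\<lambda>_. 1"] by (simp add: emeasure_space_1)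
  have mgf: "(\<integral>\<^sup>+\<omega>. ennreal (exp (c \<bullet> X \<omega>)) \<partial>M) = ennreal (exp (c \<bullet> (G *v c) / 2))" for c
  proof -
    have "(\<integral>\<^sup>+\<omega>. ennreal (exp (c \<bullet> X \<omega>)) \<partial>M) = (\<integral>\<^sup>+x. ?g x * ennreal (exp (c \<bullet> x)) \<partial>lborel)"
      using distributed_nn_integral[OF D, of "\<lambda>x. ennreal (exp (c \<bullet> x))"] by simp
    also have "\<dots> = (\<integral>\<^sup>+x. ennreal (exp (c \<bullet> (G *v c) / 2)) * ?g (x - G *v c) \<partial>lborel)"
      by (simp add: gaussian_density_shift[OF G] flip: ennreal_mult' ennreal_mult'')
    also have "\<dots> = ennreal (exp (c \<bullet> (G *v c) / 2)) * (\<integral>\<^sup>+x. ?g (x - G *v c) \<partial>lborel)"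
      by (rule nn_integral_cmult) measurable
    also have "(\<integral>\<^sup>+x. ?g (x - G *v c) \<partial>lborel) = (\<integral>\<^sup>+x. ?g x \<partial>distr lborel borel ((+) (- (G *v c))))"
      by (subst nn_integral_distr) auto
    finally show ?thesis
      by (simp add: lborel_distr_plus total)
  qed
  have "has_bochner_integral M (\<lambda>\<omega>. exp (t * (b \<bullet> X \<omega>))) (exp (t\<^sup>2 * (b \<bullet> (G *v b)) / 2))" for t
    using mgf[of "t *\<^sub>R b"]
    by (intro has_bochner_integral_nn_integral)
       (auto simp: matrix_vector_mult_scaleR power2_eq_square mult.assoc)
  then show ?thesis
    by (simp add: has_gaussian_mgf_def)
qed

section \<open>The Bayes risk of a linear estimator\<close>

text \<open>Coordinate \<open>i\<close> of the error \<open>(L A - I) m + L \<eta>\<close> is a sum of independent linear functionals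
  of \<open>m\<close> and \<open>\<eta>\<close>, given by the \<open>i\<close>-th rows of the two matrices, so its second moment is the
  sum of the two variances. Adding up the coordinates gives the traces.\<close>

lemma bayes_risk_linear:
  fixes A :: "real^'n^'k" and P :: "real^'n^'n" and N :: "real^'k^'k" and L :: "real^'k^'n"
  assumes M: "prob_space M" and P: "pos_def_matrix P" and N: "pos_def_matrix N"
    and m: "gaussian_vector M m 0 P" and \<eta>: "gaussian_vector M \<eta> 0 N"
    and ind: "indep_vectors M m \<eta>"
    and y: "\<And>\<omega>. y \<omega> = A *v m \<omega> + \<eta> \<omega>"
  shows "bayes_risk M m y (\<lambda>v. L *v v) =
    trace ((L ** A - mat 1) ** P ** transpose (L ** A - mat 1)) + trace (L ** N ** transpose L)"
proof -
  interpret prob_space M by fact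
  have [measurable]: "m \<in> borel_measurable M" "\<eta> \<in> borel_measurable M"
    using m \<eta> by (auto intro: gaussian_vector_measurable)
  have [measurable]: "(\<lambda>v. B *v v) \<in> borel_measurable borel" for B :: "real^'x^'z"
    by (intro borel_measurable_continuous_onI linear_continuous_on linear_conv_bounded_linear[THEN iffD1]
        matrix_vector_mul_linear)
  have [measurable]: "y \<in> borel_measurable M"
    unfolding y[abs_def] by measurable
  let ?D = "L ** A - mat 1"
  have coord: "has_bochner_integral M (\<lambda>\<omega>. (?D $ i \<bullet> m \<omega> + L $ i \<bullet> \<eta> \<omega>)\<^sup>2)
      (?D $ i \<bullet> (P *v (?D $ i)) + L $ i \<bullet> (N *v (L $ i)))" for i
    using P N
    by (intro gaussian_mgf_second_moment gaussian_mgf_add M indep_vectors_inner ind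
        gaussian_vector_inner_mgf m \<eta> pos_def_matrix_invertible) (auto simp: pos_def_matrix_def)
  have err: "(norm (L *v y \<omega> - m \<omega>))\<^sup>2 = (\<Sum>i\<in>UNIV. (?D $ i \<bullet> m \<omega> + L $ i \<bullet> \<eta> \<omega>)\<^sup>2)" for \<omega>
  proof -
    have "L *v y \<omega> - m \<omega> = ?D *v m \<omega> + L *v \<eta> \<omega>"
      by (simp add: y matrix_vector_right_distrib matrix_vector_mult_diff_rdistrib matrix_vector_mul_assoc)
    then have "(L *v y \<omega> - m \<omega>) $ i = ?D $ i \<bullet> m \<omega> + L $ i \<bullet> \<eta> \<omega>" for i
      by (simp only: vector_add_component matrix_vector_mul_component)
    moreover have "(norm v)\<^sup>2 = (\<Sum>i\<in>UNIV. (v $ i)\<^sup>2)" for v :: "real^'n"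
      unfolding power2_norm_eq_inner inner_vec_def by (simp add: power2_eq_square)
    ultimately show ?thesis
      by (simp only:)
  qed
  have "bayes_risk M m y (\<lambda>v. L *v v) = (\<integral>\<omega>. (norm (L *v y \<omega> - m \<omega>))\<^sup>2 \<partial>M)"
    unfolding bayes_risk_def by (subst integral_distr) simp_all
  also have "\<dots> = (\<Sum>i\<in>UNIV. ?D $ i \<bullet> (P *v (?D $ i)) + L $ i \<bullet> (N *v (L $ i)))"
    unfolding err by (intro has_bochner_integral_integral_eq has_bochner_integral_sum coord)
  finally show ?thesis
    by (simp add: trace_congruence_eq_sum sum.distrib)
qed

section \<open>The posterior covariance and the risk gap\<close>

context
  fixes A :: "real^'n^'k" and P :: "real^'n^'n" and N :: "real^'k^'k"
  assumes P: "pos_def_matrix P" and N: "pos_def_matrix N"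
begin

private abbreviation "S \<equiv> post_cov A P N"
private abbreviation "K \<equiv> S ** transpose A ** matrix_inv N"

lemma prior_noise_simps:
  shows "P ** matrix_inv P = mat 1" "matrix_inv P ** P = mat 1"
    "N ** matrix_inv N = mat 1" "matrix_inv N ** N = mat 1"
    "transpose P = P" "transpose N = N"
    "transpose (matrix_inv P) = matrix_inv P" "transpose (matrix_inv N) = matrix_inv N"
  using P N pos_def_matrix_inv[OF P] pos_def_matrix_inv[OF N]
  by (auto simp: pos_def_matrix_def matrix_inv_inverse pos_def_matrix_invertible)

lemma prior_noise_cancel:
  shows "B ** P ** matrix_inv P = B" "B ** matrix_inv P ** P = B"
    "C ** N ** matrix_inv N = C" "C ** matrix_inv N ** N = C"
  by (simp_all add: prior_noise_simps flip: matrix_mul_assoc)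

lemma precision_pos_def: "pos_def_matrix (matrix_inv P + transpose A ** matrix_inv N ** A)"
  using P N by (intro pos_def_matrix_add_congruence pos_def_matrix_inv)

lemma transpose_post_cov: "transpose S = S"
  using pos_def_matrix_inv[OF precision_pos_def] by (simp add: post_cov_def pos_def_matrix_def)

text \<open>\<open>K A = S (A\<^sup>T N\<^sup>-\<^sup>1 A) = S (S\<^sup>-\<^sup>1 - P\<^sup>-\<^sup>1)\<close>, by the definition of \<open>S\<close>. Every
  later covariance identity reduces to this one.\<close>

lemma gain_forward: "K ** A = mat 1 - S ** matrix_inv P"
proof -
  have "S ** (matrix_inv P + transpose A ** matrix_inv N ** A) = mat 1"
    unfolding post_cov_def
    using precision_pos_def by (intro matrix_inv_inverse pos_def_matrix_invertible)
  then show ?thesis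
    by (simp add: matrix_ring_simps eq_diff_eq add.commute)
qed

lemma gain_noise: "K ** N ** transpose K = S - S ** matrix_inv P ** S"
proof -
  have "K ** N ** transpose K = K ** A ** S"
    by (simp add: matrix_transpose_mul matrix_mul_assoc prior_noise_simps prior_noise_cancel transpose_post_cov)
  also have "\<dots> = S - S ** matrix_inv P ** S"
    by (simp add: gain_forward matrix_sub_rdistrib)
  finally show ?thesis .
qed

text \<open>The error of the MAP estimate splits into a prior part \<open>S P\<^sup>-\<^sup>1 S\<close> and a noise part
  \<open>S - S P\<^sup>-\<^sup>1 S\<close>.\<close>

lemma map_error_covariance:
  "(K ** A - mat 1) ** P ** transpose (K ** A - mat 1) + K ** N ** transpose K = S"
proof -
  have "mat 1 - K ** A = S ** matrix_inv P"
    by (simp add: gain_forward)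
  then have "(K ** A - mat 1) ** P ** transpose (K ** A - mat 1) = S ** matrix_inv P ** S"
    by (simp add: congruence_diff_commute[of "K ** A" "mat 1"] matrix_transpose_mul matrix_mul_assoc
        prior_noise_simps prior_noise_cancel transpose_post_cov)
  then show ?thesis
    by (simp add: gain_noise)
qed

text \<open>The right-hand side is the covariance of the estimate \<open>K y\<close>: the part of the prior variance
  that the data explain.\<close>

lemma prior_minus_post:
  "P - S = K ** N ** transpose K + (K ** A) ** P ** transpose (K ** A)"
  unfolding gain_noise gain_forward
  by (simp add: matrix_ring_simps prior_noise_simps prior_noise_cancel transpose_post_cov)

text \<open>The right-hand side is the covariance of the residual \<open>y - A K y = (I - A K) \<eta> + A S P\<^sup>-\<^sup>1 m\<close>,
  the coefficient of \<open>m\<close> being \<open>A - A K A = A S P\<^sup>-\<^sup>1\<close>.\<close>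

lemma noise_minus_fitted_post:
  "N - A ** S ** transpose A =
     transpose (mat 1 - transpose (A ** K)) ** N ** (mat 1 - transpose (A ** K))
     + (A ** S ** matrix_inv P) ** P ** transpose (A ** S ** matrix_inv P)"
proof -
  have 1: "A ** S ** matrix_inv P ** P = A ** S" "A ** K ** N = A ** S ** transpose A"
    by (simp_all add: matrix_mul_assoc prior_noise_cancel)
  have 2: "N ** transpose (A ** K) = A ** S ** transpose A"
    by (simp add: matrix_transpose_mul matrix_mul_assoc prior_noise_simps transpose_post_cov)
  have "A ** S ** transpose A ** transpose (A ** K) = A ** K ** N ** transpose (A ** K)"
    by (simp only: 1)
  also have "\<dots> = A ** (K ** N ** transpose K) ** transpose A"
    by (simp only: matrix_transpose_mul matrix_mul_assoc)
  also have "\<dots> = A ** S ** transpose A - A ** S ** matrix_inv P ** S ** transpose A"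
    unfolding gain_noise by (simp add: matrix_ring_simps)
  finally have 3: "A ** S ** transpose A ** transpose (A ** K) =
    A ** S ** transpose A - A ** S ** matrix_inv P ** S ** transpose A" .
  have "transpose (mat 1 - transpose (A ** K)) ** N ** (mat 1 - transpose (A ** K))
     = N - N ** transpose (A ** K) - A ** K ** N + A ** K ** N ** transpose (A ** K)"
    by (simp only: transpose_sub transpose_transpose transpose_mat matrix_sub_ldistrib matrix_sub_rdistrib
        matrix_mul_lid matrix_mul_rid diff_diff_eq2 diff_diff_eq) (simp add: algebra_simps)
  moreover have "(A ** S ** matrix_inv P) ** P ** transpose (A ** S ** matrix_inv P)
    = A ** S ** matrix_inv P ** S ** transpose A"
    by (simp add: 1 matrix_transpose_mul prior_noise_simps transpose_post_cov matrix_mul_assoc)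
  ultimately show ?thesis
    by (simp only: 1 2 3) simp
qed

lemma delta_prior_nonneg: "delta_prior A P N \<ge> 0"
proof -
  define Q where "Q = mat 1 - pinv A ** A"
  have Q: "transpose Q = Q" "Q ** Q = Q"
    by (simp_all add: Q_def transpose_sub pinv_projection matrix_sub_ldistrib matrix_sub_rdistrib)
  have "delta_prior A P N = trace (Q ** (P - S) ** transpose Q)"
    by (simp add: delta_prior_def Q_def[symmetric] trace_symmetric_projection[OF Q])
  also have "\<dots> = trace ((Q ** K) ** N ** transpose (Q ** K))
      + trace ((Q ** (K ** A)) ** P ** transpose (Q ** (K ** A)))"
    unfolding prior_minus_post
    by (simp only: matrix_add_ldistrib matrix_add_rdistrib trace_add matrix_transpose_mul matrix_mul_assoc)
  also have "\<dots> \<ge> 0"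
    by (intro add_nonneg_nonneg trace_congruence_nonneg P N)
  finally show ?thesis .
qed

text \<open>Since \<open>A\<^sup>+ A\<close> is an orthogonal projection, \<open>tr (A\<^sup>+ A S) = tr (A\<^sup>+ A S A\<^sup>T (A\<^sup>+)\<^sup>T)\<close>. A factor \<open>A\<^sup>+\<close> then
  comes out on each side and leaves \<open>N - A S A\<^sup>T\<close> in the middle.\<close>

lemma delta_noise_nonneg: "delta_noise A P N \<ge> 0"
proof -
  define X where "X = pinv A"
  define B where "B = mat 1 - transpose (A ** K)"
  define C where "C = A ** S ** matrix_inv P"
  have "trace (X ** A ** S) = trace (X ** A ** S ** transpose (X ** A))"
    unfolding X_def by (rule trace_symmetric_projection[symmetric]) (rule pinv_projection)+
  then have "delta_noise A P N = trace (X ** (N - A ** S ** transpose A) ** transpose X)"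
    by (simp add: delta_noise_def X_def[symmetric] trace_sub matrix_ring_simps)
  also have "\<dots> = trace ((X ** transpose B) ** N ** transpose (X ** transpose B))
      + trace ((X ** C) ** P ** transpose (X ** C))"
    unfolding noise_minus_fitted_post B_def[symmetric] C_def[symmetric]
    by (simp only: matrix_add_ldistrib matrix_add_rdistrib trace_add matrix_transpose_mul matrix_mul_assoc transpose_transpose)
  also have "\<dots> \<ge> 0"
    by (intro add_nonneg_nonneg trace_congruence_nonneg P N)
  finally show ?thesis .
qed

end

text \<open>The terms \<open>tr ((I - A\<^sup>+ A) S)\<close> and \<open>tr (A\<^sup>+ A S)\<close> hidden in the two gaps add up to \<open>tr S\<close>, the
  risk of the MAP estimate.\<close>

lemma ls_map_trace_gap:
  fixes A :: "real^'n^'k"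
  defines "X \<equiv> pinv A"
  shows "trace ((X ** A - mat 1) ** P ** transpose (X ** A - mat 1)) + trace (X ** N ** transpose X) - trace (post_cov A P N)
    = delta_prior A P N + delta_noise A P N"
proof -
  define Q where "Q = mat 1 - X ** A"
  have Q: "transpose Q = Q" "Q ** Q = Q"
    by (simp_all add: Q_def X_def transpose_sub pinv_projection matrix_sub_ldistrib matrix_sub_rdistrib)
  have "(X ** A - mat 1) ** P ** transpose (X ** A - mat 1) = Q ** P ** transpose Q"
    unfolding Q_def by (rule congruence_diff_commute)
  then have "trace ((X ** A - mat 1) ** P ** transpose (X ** A - mat 1)) = trace (Q ** P)"
    by (simp add: trace_symmetric_projection[OF Q])
  then show ?thesis
    unfolding delta_prior_def delta_noise_def X_def[symmetric] Q_def[symmetric]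
    by (simp add: Q_def matrix_sub_ldistrib matrix_sub_rdistrib trace_sub)
qed

theorem theorem3p3:
  fixes A :: "real^'n^'k"
    and Gprior :: "real^'n^'n"
    and Gnoise :: "real^'k^'k"
    and M :: "'w measure"
    and m :: "'w \<Rightarrow> real^'n"
    and \<eta> y :: "'w \<Rightarrow> real^'k"
  assumes "pos_def_matrix Gprior"
    and "pos_def_matrix Gnoise"
    and "prob_space M"
    and "gaussian_vector M m 0 Gprior"
    and "gaussian_vector M \<eta> 0 Gnoise"
    and "indep_vectors M m \<eta>"
    and "\<And>\<omega>. y \<omega> = A *v m \<omega> + \<eta> \<omega>"
  shows "delta_prior A Gprior Gnoise \<ge> 0 \<and>
         delta_noise A Gprior Gnoise \<ge> 0 \<and>
         bayes_risk M m y (ls_estimate A) - bayes_risk M m y (map_estimate A Gprior Gnoise)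
           = delta_prior A Gprior Gnoise + delta_noise A Gprior Gnoise"
proof (intro conjI)
  show "delta_prior A Gprior Gnoise \<ge> 0" "delta_noise A Gprior Gnoise \<ge> 0"
    using assms(1,2) by (rule delta_prior_nonneg, rule delta_noise_nonneg)
  note risk = bayes_risk_linear[OF assms(3,1,2,4,5,6,7)]
  have "bayes_risk M m y (map_estimate A Gprior Gnoise) = trace (post_cov A Gprior Gnoise)"
    using risk[of "post_cov A Gprior Gnoise ** transpose A ** matrix_inv Gnoise"]
    by (simp only: map_estimate_def[abs_def] map_error_covariance[OF assms(1,2)] flip: trace_add)
  then show "bayes_risk M m y (ls_estimate A) - bayes_risk M m y (map_estimate A Gprior Gnoise)
      = delta_prior A Gprior Gnoise + delta_noise A Gprior Gnoise"
    using risk[of "pinv A"] ls_map_trace_gap[of A Gprior Gnoise]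
    by (simp only: ls_estimate_def[abs_def])
qed

end
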